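(* Let $\mathcal{H}$ be a Hilbert space. If $T\in\mathfrak{X}$, then there exists a closed unbounded projection $E:\mathcal{D}(E)\to\mathcal{H}$ such that $T=E^\dagger$. Conversely, if $E$ is any closed unbounded projection, then there exists $T\in\mathfrak{X}$ such that $E^\dagger=T$. Moreover, the map $T\mapsto T^\dagger$ from $\mathfrak{X}$ onto $\tilde{\mathcal{Q}}$ is a bijection.
   Context: $R(\cdot)$, $N(\cdot)$, $\mathcal{D}(\cdot)$ denote range, nullspace and domain. $\mathfrak{X}$ is the set of all products $PQ$ of two orthogonal projections $P,Q$ among the bounded operators $L(\mathcal{H})$. $\tilde{\mathcal{Q}}$ is the set of closed unbounded projections, where "unbounded" means "not necessarily bounded": linear operators $E$ with dense domain $\mathcal{D}(E)\subseteq\mathcal{H}$ such that $\mathcal{D}(E)=N(E)\dot{+}R(E)$ (direct sum), $N(E)$ and $R(E)$ are closed in $\mathcal{H}$, and $E(Ex)=Ex$ for all $x\in\mathcal{D}(E)$. For $T\in L(\mathcal{H})$, the Moore-Penrose pseudoinverse $T^\dagger$ is the (possibly unbounded) operator with domain $R(T)\oplus R(T)^\perp$ defined by $T^\dagger(Tx)=x$ for $x\in N(T)^\perp$ and $T^\dagger|_{R(T)^\perp}=0$. Likewise, for $E\in\tilde{\mathcal{Q}}$, $E^\dagger$ is the operator with domain $R(E)\oplus R(E)^\perp=\mathcal{H}$ defined by $E^\dagger(Ex)=x$ for $x\in\mathcal{D}(E)\cap N(E)^\perp$ and $E^\dagger|_{R(E)^\perp}=0$. *)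

theory Defs
  imports "HOL-Analysis.Analysis" "HOL-Library.Set_Algebras"
begin

text \<open>
  The scalar fields of Hilbert spaces. A commutative field with a multiplicative norm extending
  that of the reals is the real or the complex field, and the last axiom then
  forces \<open>conjg\<close> to be the identity or complex conjugation, respectively.
\<close>

class rc_field = real_normed_field +
  fixes conjg :: "'a \<Rightarrow> 'a"
  assumes conjg_add: "conjg (x + y) = conjg x + conjg y"
    and conjg_mult: "conjg (x * y) = conjg x * conjg y"
    and mult_conjg: "x * conjg x = (norm x)\<^sup>2 *\<^sub>R 1"

instantiation real :: rc_field
begin
definition conjg_real :: "real \<Rightarrow> real" where "conjg_real x = x"
instance by standard (auto simp: conjg_real_def power2_eq_square)
end

instantiation complex :: rc_field
begin
definition conjg_complex :: "complex \<Rightarrow> complex" where "conjg_complex = cnj"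
instance
  by standard
    (auto simp: conjg_complex_def complex_norm_square scaleR_conv_of_real simp del: of_real_power)
end

text \<open>
  Completeness comes from the class \<^class>\<open>banach\<close>; the real scalar multiplication and the norm
  of that class are tied to \<open>scl\<close> and to the inner product, which is linear
  in the first argument.
\<close>

locale hilbert_space = vector_space scl
  for scl :: "'k::rc_field \<Rightarrow> 'a::banach \<Rightarrow> 'a" +
  fixes ip :: "'a \<Rightarrow> 'a \<Rightarrow> 'k"
  assumes scale_of_real: "scl (of_real r) x = r *\<^sub>R x"
    and ip_add_left: "ip (x + y) z = ip x z + ip y z"
    and ip_scale_left: "ip (scl c x) y = c * ip x y"
    and ip_commute: "ip x y = conjg (ip y x)"
    and ip_self: "ip x x = of_real ((norm x)\<^sup>2)"

lemma hilbert_space_real: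
  "hilbert_space (scaleR :: real \<Rightarrow> 'a::{real_inner,banach} \<Rightarrow> 'a) inner"
  by unfold_locales
    (auto simp: algebra_simps conjg_real_def inner_commute power2_norm_eq_inner)

lemma hilbert_space_complex: "hilbert_space (*) (\<lambda>x y :: complex. x * cnj y)"
  by unfold_locales
    (auto simp: algebra_simps conjg_complex_def complex_norm_square scaleR_conv_of_real
      simp del: of_real_power)

definition orth :: "('a \<Rightarrow> 'a \<Rightarrow> 'k::zero) \<Rightarrow> 'a set \<Rightarrow> 'a set" where
  "orth ip S = {x. \<forall>y\<in>S. ip x y = 0}"

text \<open>
  A not necessarily bounded operator is a partial function with domain \<^const>\<open>dom\<close> and range
  \<^const>\<open>ran\<close>, so that equality of operators includes equality of domains. An operator \<open>T\<close>
  that is defined everywhere is a function, and as a partial function it is \<open>Some \<circ> T\<close>.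
\<close>

definition linear_operator :: "('k::rc_field \<Rightarrow> 'a::banach \<Rightarrow> 'a) \<Rightarrow> ('a \<rightharpoonup> 'a) \<Rightarrow> bool" where
  "linear_operator scl A \<longleftrightarrow>
     module.subspace scl (dom A) \<and>
     (\<forall>x\<in>dom A. \<forall>y\<in>dom A. the (A (x + y)) = the (A x) + the (A y)) \<and>
     (\<forall>c. \<forall>x\<in>dom A. the (A (scl c x)) = scl c (the (A x)))"

definition null_space :: "('a \<rightharpoonup> 'a::zero) \<Rightarrow> 'a set" where
  "null_space A = {x. A x = Some 0}"

definition bounded_operator :: "('k::rc_field \<Rightarrow> 'a::banach \<Rightarrow> 'a) \<Rightarrow> ('a \<Rightarrow> 'a) \<Rightarrow> bool" where
  "bounded_operator scl T \<longleftrightarrow> bounded_linear T \<and> (\<forall>c x. T (scl c x) = scl c (T x))"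

definition orthogonal_projection ::
    "('k::rc_field \<Rightarrow> 'a::banach \<Rightarrow> 'a) \<Rightarrow> ('a \<Rightarrow> 'a \<Rightarrow> 'k) \<Rightarrow> ('a \<Rightarrow> 'a) \<Rightarrow> bool" where
  "orthogonal_projection scl ip P \<longleftrightarrow>
     bounded_operator scl P \<and> P \<circ> P = P \<and> (\<forall>x y. ip (P x) y = ip x (P y))"

definition projection_products ::
    "('k::rc_field \<Rightarrow> 'a::banach \<Rightarrow> 'a) \<Rightarrow> ('a \<Rightarrow> 'a \<Rightarrow> 'k) \<Rightarrow> ('a \<Rightarrow> 'a) set" where
  "projection_products scl ip =
     {P \<circ> Q |P Q. orthogonal_projection scl ip P \<and> orthogonal_projection scl ip Q}"

definition closed_unbounded_projections ::
    "('k::rc_field \<Rightarrow> 'a::banach \<Rightarrow> 'a) \<Rightarrow> ('a \<rightharpoonup> 'a) set" where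
  "closed_unbounded_projections scl =
     {E. linear_operator scl E \<and>
         closure (dom E) = UNIV \<and>
         dom E = null_space E + ran E \<and> null_space E \<inter> ran E = {0} \<and>
         closed (null_space E) \<and> closed (ran E) \<and>
         (\<forall>x\<in>dom E. E (the (E x)) = E x)}"

text \<open>
  The domain is \<open>R(A) \<oplus> R(A)\<^sup>\<bottom>\<close>. The value at \<open>A x + v\<close>, where \<open>x\<close> is in the domain of \<open>A\<close> and
  orthogonal to the null space and \<open>v\<close> is orthogonal to the range, is \<open>x\<close>;
  such an \<open>x\<close> exists for every point of the domain when \<open>A\<close> is linear and its null space is closed.
\<close>

definition pseudoinverse ::
    "('a \<Rightarrow> 'a \<Rightarrow> 'k::zero) \<Rightarrow> ('a \<rightharpoonup> 'a::banach) \<Rightarrow> ('a \<rightharpoonup> 'a)" where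
  "pseudoinverse ip A = (\<lambda>y.
     if y \<in> ran A + orth ip (ran A)
     then Some (THE x. x \<in> orth ip (null_space A) \<and>
                       (\<exists>u v. A x = Some u \<and> v \<in> orth ip (ran A) \<and> y = u + v))
     else None)"

end

theory Submission
  imports Defs
begin

text \<open>
  The pseudoinverse of a densely defined linear operator \<open>A\<close> with closed null space interchanges
  \<open>N(A)\<close> with \<open>R(A)\<^sup>\<bottom>\<close> and \<open>R(A)\<close> with \<open>N(A)\<^sup>\<bottom>\<close>, and it is an involution. It therefore
  suffices to show that it maps \<open>\<XX>\<close> into the closed unbounded projections and vice versa.
  If \<open>T = P Q\<close> and \<open>x \<in> N(T)\<^sup>\<bottom>\<close>, then \<open>Q x = x\<close>, so that \<open>x - T x = x - P x\<close> is orthogonal to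
  \<open>R(T)\<close>; thus \<open>x = T x + (x - T x)\<close> is a fixed point of \<open>T\<^sup>\<dagger>\<close>. If \<open>E\<close> is a closed unbounded
  projection and \<open>P\<close>, \<open>Q\<close> are the orthogonal projections onto \<open>N(E)\<^sup>\<bottom>\<close> and \<open>R(E)\<close>, then
  \<open>Q y - P Q y \<in> N(E)\<close> gives \<open>E (P Q y) = Q y\<close>, so \<open>E\<^sup>\<dagger> = P Q\<close>.
\<close>

section \<open>Scalar conjugation, the inner product and the Cauchy-Schwarz inequality\<close>

lemma conjg_of_real [simp]: "conjg (of_real r :: 'k::rc_field) = of_real r"
proof (cases "r = 0")
  case True
  \<comment> \<open>Cancelling \<open>r\<close> in \<open>mult_conjg\<close> says nothing at 0, so
    additivity is used there.\<close>
  have "conjg (0 + 0 :: 'k) = conjg 0 + conjg 0" by (rule conjg_add)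
  then show ?thesis using True by simp
next
  case False
  have "of_real r * conjg (of_real r) = (of_real r * of_real r :: 'k)"
    by (simp add: mult_conjg power2_eq_square of_real_def)
  then show ?thesis using False by simp
qed

lemma conjg_zero [simp]: "conjg (0 :: 'k::rc_field) = 0"
  using conjg_of_real[of 0] by simp

lemma mult_conjg_of_real: "z * conjg z = (of_real ((norm z)\<^sup>2) :: 'k::rc_field)"
  by (simp add: mult_conjg of_real_def)

context hilbert_space
begin

lemma ip_zero_left [simp]: "ip 0 y = 0"
  using ip_add_left[of 0 0 y] by simp

lemma ip_minus_left: "ip (- x) y = - ip x y"
  using ip_add_left[of x "- x" y] by (simp add: eq_neg_iff_add_eq_0 add.commute)

lemma ip_diff_left: "ip (x - y) z = ip x z - ip y z"
  using ip_add_left[of x "- y" z] by (simp add: ip_minus_left)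

lemma ip_add_right: "ip x (y + z) = ip x y + ip x z"
  by (metis conjg_add ip_add_left ip_commute)

lemma ip_zero_right [simp]: "ip x 0 = 0"
  using ip_add_right[of x 0 0] by simp

lemma ip_minus_right: "ip x (- y) = - ip x y"
  using ip_add_right[of x y "- y"] by (simp add: eq_neg_iff_add_eq_0 add.commute)

lemma ip_diff_right: "ip x (y - z) = ip x y - ip x z"
  using ip_add_right[of x y "- z"] by (simp add: ip_minus_right)

lemma ip_scale_right: "ip x (scl c y) = conjg c * ip x y"
  by (metis conjg_mult ip_commute ip_scale_left)

lemma ip_eq_zero_commute: "ip x y = 0 \<longleftrightarrow> ip y x = 0"
  by (metis conjg_zero ip_commute)

lemma ip_self_eq_zero [simp]: "ip x x = 0 \<longleftrightarrow> x = 0"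
  by (simp add: ip_self)

lemma parallelogram:
  fixes x y :: 'a
  shows "(norm (x + y))\<^sup>2 + (norm (x - y))\<^sup>2 = 2 * (norm x)\<^sup>2 + 2 * (norm y)\<^sup>2"
proof -
  have "ip (x + y) (x + y) + ip (x - y) (x - y) = 2 * ip x x + 2 * ip y y"
    by (simp add: ip_add_left ip_add_right ip_diff_left ip_diff_right)
  then have "(of_real ((norm (x + y))\<^sup>2 + (norm (x - y))\<^sup>2) :: 'k)
      = of_real (2 * (norm x)\<^sup>2 + 2 * (norm y)\<^sup>2)"
    by (simp add: ip_self)
  then show ?thesis by (simp only: of_real_eq_iff)
qed

lemma pythagoras:
  assumes "ip x y = 0"
  shows "(norm (x + y))\<^sup>2 = (norm x)\<^sup>2 + (norm y)\<^sup>2"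
proof -
  have "ip (x + y) (x + y) = ip x x + ip y y"
    using assms ip_eq_zero_commute[of x y] by (simp add: ip_add_left ip_add_right)
  then have "(of_real ((norm (x + y))\<^sup>2) :: 'k) = of_real ((norm x)\<^sup>2 + (norm y)\<^sup>2)"
    by (simp add: ip_self)
  then show ?thesis by (simp only: of_real_eq_iff)
qed

text \<open>The subtracted vector is the projection of \<open>x\<close> onto the line spanned by
  \<open>y\<close>. The exact value of the remainder serves twice: it yields Cauchy-Schwarz, and it
  turns minimal distance into orthogonality.\<close>

lemma norm_residual:
  assumes "y \<noteq> 0"
  shows "(norm (x - scl (ip x y / of_real ((norm y)\<^sup>2)) y))\<^sup>2
    = (norm x)\<^sup>2 - (norm (ip x y))\<^sup>2 / (norm y)\<^sup>2"
proof -
  define c where "c = ip x y / of_real ((norm y)\<^sup>2)"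
  have n: "(of_real ((norm y)\<^sup>2) :: 'k) \<noteq> 0" using assms by simp
  have "ip (x - scl c y) y = 0"
    using n by (simp add: ip_diff_left ip_scale_left ip_self c_def)
  \<comment> \<open>The residual is orthogonal to \<open>y\<close>, so its second copy may be
    replaced by \<open>x\<close>.\<close>
  then have "ip (x - scl c y) (x - scl c y) = ip (x - scl c y) x"
    by (simp add: ip_diff_right ip_scale_right)
  also have "\<dots> = ip x x - c * ip y x" by (simp add: ip_diff_left ip_scale_left)
  also have "c * ip y x = ip x y * conjg (ip x y) / of_real ((norm y)\<^sup>2)"
    using ip_commute[of y x] by (simp add: c_def)
  also have "\<dots> = of_real ((norm (ip x y))\<^sup>2 / (norm y)\<^sup>2)"
    by (simp only: mult_conjg_of_real of_real_divide)
  finally have "(of_real ((norm (x - scl c y))\<^sup>2) :: 'k)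
      = of_real ((norm x)\<^sup>2 - (norm (ip x y))\<^sup>2 / (norm y)\<^sup>2)"
    by (simp only: ip_self of_real_diff)
  then show ?thesis by (simp only: of_real_eq_iff c_def)
qed

lemma cauchy_schwarz: "norm (ip x y) \<le> norm x * norm y"
proof (cases "y = 0")
  case False
  have "0 \<le> (norm x)\<^sup>2 - (norm (ip x y))\<^sup>2 / (norm y)\<^sup>2"
    using norm_residual[OF False, of x] by (metis zero_le_power2)
  then have "(norm (ip x y))\<^sup>2 \<le> (norm x * norm y)\<^sup>2"
    using False by (simp add: field_simps power_mult_distrib)
  then show ?thesis by (rule power2_le_imp_le) simp
qed simp

lemma tendsto_ip_left:
  assumes "(f \<longlongrightarrow> l) F"
  shows "((\<lambda>n. ip (f n) y) \<longlongrightarrow> ip l y) F"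
proof -
  have "((\<lambda>n. norm (f n - l) * norm y) \<longlongrightarrow> 0) F"
    using assms by (intro tendsto_mult_left_zero tendsto_norm_zero) (simp add: LIM_zero_iff)
  then have "((\<lambda>n. ip (f n) y - ip l y) \<longlongrightarrow> 0) F"
    by (rule Lim_null_comparison[rotated]) (simp add: cauchy_schwarz flip: ip_diff_left)
  then show ?thesis by (simp add: LIM_zero_iff)
qed

section \<open>Orthogonal complements and projections onto closed subspaces\<close>

lemma in_orthD: "x \<in> orth ip S \<Longrightarrow> y \<in> S \<Longrightarrow> ip x y = 0"
  by (simp add: orth_def)

lemma in_orthD': "x \<in> orth ip S \<Longrightarrow> y \<in> S \<Longrightarrow> ip y x = 0"
  using in_orthD ip_eq_zero_commute by blast

lemma subspace_orth: "subspace (orth ip S)"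
  by (auto simp: subspace_def orth_def ip_add_left ip_scale_left)

lemma closed_orth: "closed (orth ip S)"
  unfolding closed_sequential_limits
proof (intro allI impI, elim conjE)
  fix f l assume f: "\<forall>n. f n \<in> orth ip S" and lim: "f \<longlonglongrightarrow> l"
  have "ip l y = 0" if "y \<in> S" for y
  proof -
    have "(\<lambda>n. ip (f n) y) \<longlonglongrightarrow> ip l y" by (rule tendsto_ip_left[OF lim])
    moreover have "ip (f n) y = 0" for n using f that in_orthD by blast
    ultimately show ?thesis by (simp add: LIMSEQ_const_iff)
  qed
  then show "l \<in> orth ip S" by (simp add: orth_def)
qed

lemma subset_orth_orth: "S \<subseteq> orth ip (orth ip S)"
  by (auto simp: orth_def[of ip "orth ip S"] in_orthD')

lemma Int_orth: "x \<in> S \<Longrightarrow> x \<in> orth ip S \<Longrightarrow> x = 0"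
  using in_orthD by fastforce

text \<open>
  Minimizing the distance over \<open>S\<close> rather than over its closure avoids having to show that the
  closure is a subspace.
\<close>

lemma orthogonal_decomposition_closure:
  assumes S: "subspace S"
  shows "\<exists>s\<in>closure S. x - s \<in> orth ip S"
proof -
  define D where "D = (INF s\<in>S. (norm (x - s))\<^sup>2)"
  have bdd: "bdd_below ((\<lambda>s. (norm (x - s))\<^sup>2) ` S)"
    by (rule bdd_belowI[of _ 0]) auto
  have S0: "0 \<in> S" using S by (rule subspace_0)
  have D_le: "D \<le> (norm (x - s))\<^sup>2" if "s \<in> S" for s
    unfolding D_def using that bdd by (intro cINF_lower)
  \<comment> \<open>A minimizing sequence for the squared distance \<open>D\<close> from
    \<open>x\<close> to \<open>S\<close>.\<close>
  have "\<exists>s\<in>S. (norm (x - s))\<^sup>2 < D + inverse (real (Suc n))" for n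
    using cINF_less_iff[OF _ bdd, of "D + inverse (real (Suc n))"] S0 by (auto simp: D_def)
  then obtain s where s: "\<And>n. s n \<in> S"
    and s_less: "\<And>n. (norm (x - s n))\<^sup>2 < D + inverse (real (Suc n))"
    by metis
  have s_near: "(norm (s m - s n))\<^sup>2 \<le> 2 * inverse (real (Suc m)) + 2 * inverse (real (Suc n))"
    for m n
  proof -
    \<comment> \<open>The midpoint of \<open>s m\<close> and \<open>s n\<close> lies in
      \<open>S\<close>, so the sum in the parallelogram law has squared norm at least
      \<open>4 * D\<close>. This cancels the \<open>D\<close> terms on the other side and leaves
      only the two error terms.\<close>
    have mid: "scl (of_real (1/2)) (s m + s n) \<in> S"
      by (intro subspace_scale subspace_add S s)
    have "(x - s m) + (x - s n) = 2 *\<^sub>R (x - scl (of_real (1/2)) (s m + s n))"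
      by (simp only: scale_of_real) (simp add: algebra_simps scaleR_2)
    then have "(norm ((x - s m) + (x - s n)))\<^sup>2
        = 4 * (norm (x - scl (of_real (1/2)) (s m + s n)))\<^sup>2"
      by (simp add: power_mult_distrib)
    then have "4 * D \<le> (norm ((x - s m) + (x - s n)))\<^sup>2"
      using D_le[OF mid] by simp
    moreover have "norm ((x - s m) - (x - s n)) = norm (s m - s n)"
      using norm_minus_commute[of "s m" "s n"] by (simp add: algebra_simps)
    ultimately show ?thesis
      using parallelogram[of "x - s m" "x - s n"] s_less[of m] s_less[of n] by simp
  qed
  have "Cauchy s"
  proof (rule metric_CauchyI)
    fix e :: real assume "e > 0"
    \<comment> \<open>With both indices at least \<open>N\<close>, the two error terms are each
      below half of the square of \<open>e\<close>.\<close>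
    then obtain N where N: "inverse (real (Suc N)) < e\<^sup>2 / 4"
      using reals_Archimedean[of "e\<^sup>2 / 4"] by auto
    have "dist (s m) (s n) < e" if "m \<ge> N" "n \<ge> N" for m n
    proof -
      have "inverse (real (Suc m)) \<le> inverse (real (Suc N))"
        "inverse (real (Suc n)) \<le> inverse (real (Suc N))"
        using that by (simp_all add: field_simps)
      then have "(norm (s m - s n))\<^sup>2 < e\<^sup>2" using s_near[of m n] N by linarith
      then show ?thesis using \<open>e > 0\<close> by (simp add: dist_norm power2_less_imp_less)
    qed
    then show "\<exists>N. \<forall>m\<ge>N. \<forall>n\<ge>N. dist (s m) (s n) < e" by blast
  qed
  then obtain l where l: "s \<longlonglongrightarrow> l" using Cauchy_convergent_iff convergent_def by blast
  have "(norm (x - l))\<^sup>2 \<le> D"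
  proof (rule LIMSEQ_le)
    show "(\<lambda>n. (norm (x - s n))\<^sup>2) \<longlonglongrightarrow> (norm (x - l))\<^sup>2" by (intro tendsto_intros l)
    show "(\<lambda>n. D + inverse (real (Suc n))) \<longlonglongrightarrow> D"
      using tendsto_add[OF tendsto_const LIMSEQ_inverse_real_of_nat, of D] by simp
    show "\<exists>N. \<forall>n\<ge>N. (norm (x - s n))\<^sup>2 \<le> D + inverse (real (Suc n))"
      using s_less less_imp_le by blast
  qed
  \<comment> \<open>The limit \<open>l\<close> may lie outside \<open>S\<close>, but
    \<open>s n + w\<close> lies in \<open>S\<close> for every \<open>n\<close>; the bound passes to
    the limit.\<close>
  moreover have "D \<le> (norm (x - l - w))\<^sup>2" if "w \<in> S" for w
  proof (rule LIMSEQ_le_const)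
    show "(\<lambda>n. (norm (x - s n - w))\<^sup>2) \<longlonglongrightarrow> (norm (x - l - w))\<^sup>2" by (intro tendsto_intros l)
    have "D \<le> (norm (x - s n - w))\<^sup>2" for n
      using D_le[OF subspace_add[OF S s that], of n] by (simp add: diff_diff_eq)
    then show "\<exists>N. \<forall>n\<ge>N. D \<le> (norm (x - s n - w))\<^sup>2" by blast
  qed
  ultimately have min: "(norm (x - l))\<^sup>2 \<le> (norm (x - l - w))\<^sup>2" if "w \<in> S" for w
    using that order_trans by blast
  have "ip (x - l) y = 0" if y: "y \<in> S" for y
  proof (cases "y = 0")
    case False
    \<comment> \<open>Take for \<open>w\<close> the projection of \<open>x - l\<close> onto the line
      through \<open>y\<close>. Removing it lowers the squared norm by exactly this quotient, which
      minimality forbids to be positive.\<close>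
    have "(norm (ip (x - l) y))\<^sup>2 / (norm y)\<^sup>2 \<le> 0"
      using min[OF subspace_scale[OF S y], of "ip (x - l) y / of_real ((norm y)\<^sup>2)"]
        norm_residual[OF False, of "x - l"] by linarith
    then show ?thesis using False by (simp add: divide_le_0_iff)
  qed simp
  moreover have "l \<in> closure S" using l s closure_sequential by blast
  ultimately show ?thesis by (auto simp: orth_def)
qed

lemma orthogonal_decomposition:
  assumes "subspace S" "closed S"
  obtains s where "s \<in> S" "x - s \<in> orth ip S"
  using orthogonal_decomposition_closure[OF assms(1), of x] assms(2) by auto

text \<open>If \<open>x\<close> is orthogonal to \<open>S\<close>, the closed set
  \<open>orth ip {x}\<close> contains \<open>S\<close>, hence the whole space, hence
  \<open>x\<close> itself.\<close>

lemma orth_eq_zeroI: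
  assumes "closure S = UNIV"
  shows "orth ip S = {0}"
proof -
  have "x = 0" if "x \<in> orth ip S" for x
  proof -
    have "S \<subseteq> orth ip {x}" using that by (auto simp: orth_def intro: in_orthD')
    then have "x \<in> orth ip {x}"
      using closure_minimal[OF _ closed_orth] assms by blast
    then show ?thesis by (simp add: orth_def)
  qed
  moreover have "0 \<in> orth ip S" by (rule subspace_0[OF subspace_orth])
  ultimately show ?thesis by blast
qed

text \<open>Splitting off a component in \<open>closure S\<close> leaves a remainder in
  \<open>orth ip S\<close>, which vanishes.\<close>

lemma closure_eq_UNIV:
  assumes "subspace S" "orth ip S \<subseteq> {0}"
  shows "closure S = UNIV"
  using orthogonal_decomposition_closure[OF assms(1)] assms(2)
  by (metis UNIV_eq_I eq_iff_diff_eq_0 singletonD subsetD)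

text \<open>The remainder \<open>x - s\<close> of a vector of the double complement lies both in
  \<open>orth ip S\<close> and in its complement.\<close>

lemma orth_orth:
  assumes "subspace S" "closed S"
  shows "orth ip (orth ip S) = S"
proof
  show "orth ip (orth ip S) \<subseteq> S"
  proof
    fix x assume x: "x \<in> orth ip (orth ip S)"
    obtain s where s: "s \<in> S" "x - s \<in> orth ip S"
      using orthogonal_decomposition[OF assms] .
    have "x - s \<in> orth ip (orth ip S)"
      using x s(1) subset_orth_orth by (intro subspace_diff subspace_orth) auto
    then have "x - s = 0" using s(2) Int_orth by blast
    then show "x \<in> S" using s(1) by simp
  qed
qed (rule subset_orth_orth)

text \<open>\<open>P\<close> is chosen pointwise from the orthogonal decomposition. Uniqueness of
  the decomposition then makes it additive, homogeneous and idempotent, and Pythagoras bounds it by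
  1.\<close>

lemma obtain_orthogonal_projection:
  assumes S: "subspace S" "closed S"
  obtains P where "orthogonal_projection scl ip P" "\<And>x. P x \<in> S" "\<And>x. x - P x \<in> orth ip S"
proof -
  obtain P where P: "\<And>x. P x \<in> S" and P': "\<And>x. x - P x \<in> orth ip S"
    using orthogonal_decomposition_closure[OF S(1)] closure_closed[OF S(2)] by metis
  have unique: "P x = y" if "y \<in> S" "x - y \<in> orth ip S" for x y
  proof -
    have "(x - y) - (x - P x) \<in> orth ip S"
      using subspace_orth that(2) P' by (rule subspace_diff)
    moreover have "P x - y \<in> S" using that(1) P by (intro subspace_diff S)
    ultimately have "P x - y = 0" using Int_orth[of "P x - y" S] by simp
    then show ?thesis by simp
  qed
  have add: "P (x + y) = P x + P y" for x y
    using subspace_add[OF subspace_orth P'[of x] P'[of y]]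
    by (intro unique subspace_add S P) (simp add: algebra_simps)
  have scale: "P (scl c x) = scl c (P x)" for c x
    using subspace_scale[OF subspace_orth P'[of x], of c]
    by (intro unique subspace_scale S P) (simp add: scale_right_diff_distrib)
  have "norm (P x) \<le> norm x" for x
  proof (rule power2_le_imp_le)
    have "ip (P x) (x - P x) = 0" using P P' in_orthD' by blast
    from pythagoras[OF this] show "(norm (P x))\<^sup>2 \<le> (norm x)\<^sup>2" by simp
  qed simp
  then have "bounded_linear P"
    using scale[of "of_real _"]
    by (intro bounded_linear_intro[of _ 1]) (simp_all add: add scale_of_real)
  moreover have "P (P x) = P x" for x
    using P subspace_0[OF subspace_orth] by (intro unique) auto
  moreover have "ip (P x) y = ip x (P y)" for x y
  proof -
    \<comment> \<open>Both sides of the symmetry equal \<open>ip (P x) (P y)\<close>.\<close>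
    have "ip (P x) (y - P y) = 0" using P P' in_orthD' by blast
    moreover have "ip (x - P x) (P y) = 0" using P P' in_orthD by blast
    ultimately show ?thesis by (simp add: ip_diff_left ip_diff_right)
  qed
  ultimately have "orthogonal_projection scl ip P"
    by (simp add: orthogonal_projection_def bounded_operator_def scale fun_eq_iff)
  then show ?thesis using P P' that by blast
qed

section \<open>Linear operators that need not be everywhere defined\<close>

lemma linear_operatorI:
  assumes "subspace (dom A)"
    and "\<And>x y u v. A x = Some u \<Longrightarrow> A y = Some v \<Longrightarrow> A (x + y) = Some (u + v)"
    and "\<And>c x u. A x = Some u \<Longrightarrow> A (scl c x) = Some (scl c u)"
  shows "linear_operator scl A"
  unfolding linear_operator_def using assms by fastforce

lemma subspace_dom:
  assumes "linear_operator scl A"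
  shows "subspace (dom A)"
  using assms by (simp add: linear_operator_def)

lemma linear_operator_add:
  assumes A: "linear_operator scl A" and "A x = Some u" "A y = Some v"
  shows "A (x + y) = Some (u + v)"
proof -
  have "x + y \<in> dom A"
    using assms by (intro subspace_add subspace_dom) auto
  moreover have "the (A (x + y)) = u + v"
    using assms unfolding linear_operator_def by (metis domI option.sel)
  ultimately show ?thesis by auto
qed

lemma linear_operator_scale:
  assumes A: "linear_operator scl A" and "A x = Some u"
  shows "A (scl c x) = Some (scl c u)"
proof -
  have "scl c x \<in> dom A"
    using assms by (intro subspace_scale subspace_dom) auto
  moreover have "the (A (scl c x)) = scl c u"
    using assms unfolding linear_operator_def by (metis domI option.sel)
  ultimately show ?thesis by auto
qed

lemma linear_operator_zero:
  assumes "linear_operator scl A"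
  shows "A 0 = Some 0"
proof -
  have "0 \<in> dom A" by (rule subspace_0[OF subspace_dom[OF assms]])
  then obtain u where "A 0 = Some u" by blast
  from linear_operator_scale[OF assms this, of 0] show ?thesis by simp
qed

lemma linear_operator_diff:
  assumes A: "linear_operator scl A" and "A x = Some u" "A y = Some v"
  shows "A (x - y) = Some (u - v)"
  using linear_operator_add[OF A assms(2) linear_operator_scale[OF A assms(3), of "- 1"]] by simp

lemma subspace_null_space:
  assumes "linear_operator scl A"
  shows "subspace (null_space A)"
  using linear_operator_add[OF assms] linear_operator_scale[OF assms] linear_operator_zero[OF assms]
  by (fastforce simp: subspace_def null_space_def)

lemma subspace_ran:
  assumes "linear_operator scl A"
  shows "subspace (ran A)"
proof (rule subspaceI)
  show "0 \<in> ran A" using linear_operator_zero[OF assms] by (auto simp: ran_def)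
  show "x + y \<in> ran A" if "x \<in> ran A" "y \<in> ran A" for x y
    using that linear_operator_add[OF assms] unfolding ran_def by blast
  show "scl c x \<in> ran A" if "x \<in> ran A" for c x
    using that linear_operator_scale[OF assms] unfolding ran_def by blast
qed

text \<open>This supplies the preimage that the pseudoinverse selects. Removing the null space
  component of \<open>z\<close> changes neither membership in the domain nor the value.\<close>

lemma linear_operator_decomposition:
  assumes A: "linear_operator scl A" "closed (null_space A)" and z: "A z = Some u"
  obtains x where "x \<in> orth ip (null_space A)" "A x = Some u" "z - x \<in> null_space A"
proof -
  obtain n where n: "n \<in> null_space A" "z - n \<in> orth ip (null_space A)"
    using orthogonal_decomposition[OF subspace_null_space[OF A(1)] A(2)] .
  then have "A (z - n) = Some (u - 0)"
    using linear_operator_diff[OF A(1) z] by (simp add: null_space_def)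
  with n show ?thesis using that[of "z - n"] by simp
qed

section \<open>The pseudoinverse: graph, null space, range, domain and involution\<close>

text \<open>Describes the graph of the pseudoinverse without \<open>THE\<close> and without a
  separate domain test; the later arguments about its values rest on this form.\<close>

lemma pseudoinverse_eq_Some_iff:
  assumes A: "linear_operator scl A" "closed (null_space A)"
  shows "pseudoinverse ip A y = Some x \<longleftrightarrow> x \<in> orth ip (null_space A) \<and>
    (\<exists>u v. A x = Some u \<and> v \<in> orth ip (ran A) \<and> y = u + v)" (is "_ \<longleftrightarrow> ?R y x")
proof -
  have unique: "x = x'" if "?R y x" "?R y x'" for x x'
  proof -
    from that obtain u v u' v' where uv: "A x = Some u" "v \<in> orth ip (ran A)"
      "A x' = Some u'" "v' \<in> orth ip (ran A)" "u + v = u' + v'" by auto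
    have d: "A (x - x') = Some (u - u')" by (rule linear_operator_diff[OF A(1) uv(1,3)])
    \<comment> \<open>This vector lies in the range and in its complement, so it is 0. Then
      \<open>x - x'\<close> lies in the null space and in its complement.\<close>
    have "u - u' = v' - v" using uv(5) by (simp add: algebra_simps)
    moreover have "v' - v \<in> orth ip (ran A)" using uv by (intro subspace_diff subspace_orth)
    moreover have "u - u' \<in> ran A" using d by (rule ranI)
    ultimately have "u - u' = 0" using Int_orth by metis
    then have "x - x' \<in> null_space A" using d by (simp add: null_space_def)
    moreover have "x - x' \<in> orth ip (null_space A)"
      using that by (intro subspace_diff subspace_orth) auto
    ultimately show ?thesis using Int_orth[of "x - x'"] by simp
  qed
  have "(\<exists>x. ?R y x) \<longleftrightarrow> y \<in> ran A + orth ip (ran A)"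
  proof
    assume "y \<in> ran A + orth ip (ran A)"
    then obtain u v z where "y = u + v" "v \<in> orth ip (ran A)" "A z = Some u"
      by (auto simp: set_plus_def ran_def)
    then show "\<exists>x. ?R y x" using linear_operator_decomposition[OF A, of z u] by metis
  next
    assume "\<exists>x. ?R y x"
    then show "y \<in> ran A + orth ip (ran A)" by (blast intro: ranI)
  qed
  moreover have "(THE x. ?R y x) = x" if "?R y x" for x
    using that unique[OF _ that] by (rule the_equality)
  ultimately show ?thesis unfolding pseudoinverse_def by auto
qed

lemma dom_pseudoinverse: "dom (pseudoinverse ip A) = ran A + orth ip (ran A)"
  by (auto simp: pseudoinverse_def dom_def)

lemma subspace_set_plus:
  assumes "subspace S" "subspace U"
  shows "subspace (S + U)"
  using subspace_sums[OF assms] by (rule back_subst[of subspace]) (auto simp: set_plus_def)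

lemma linear_operator_pseudoinverse:
  assumes A: "linear_operator scl A" "closed (null_space A)"
  shows "linear_operator scl (pseudoinverse ip A)"
proof (rule linear_operatorI)
  show "subspace (dom (pseudoinverse ip A))"
    unfolding dom_pseudoinverse
    by (intro subspace_set_plus subspace_ran subspace_orth A)
next
  fix y y' x x'
  assume "pseudoinverse ip A y = Some x" "pseudoinverse ip A y' = Some x'"
  then obtain u v u' v' where "x \<in> orth ip (null_space A)" "x' \<in> orth ip (null_space A)"
    "A x = Some u" "v \<in> orth ip (ran A)" "y = u + v"
    "A x' = Some u'" "v' \<in> orth ip (ran A)" "y' = u' + v'"
    unfolding pseudoinverse_eq_Some_iff[OF A] by blast
  then have "x + x' \<in> orth ip (null_space A)" "A (x + x') = Some (u + u')"
    "v + v' \<in> orth ip (ran A)" "y + y' = (u + u') + (v + v')"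
    by (auto intro: subspace_add subspace_orth linear_operator_add A)
  then show "pseudoinverse ip A (y + y') = Some (x + x')"
    unfolding pseudoinverse_eq_Some_iff[OF A] by blast
next
  fix c y x
  assume "pseudoinverse ip A y = Some x"
  then obtain u v where "x \<in> orth ip (null_space A)"
    "A x = Some u" "v \<in> orth ip (ran A)" "y = u + v"
    unfolding pseudoinverse_eq_Some_iff[OF A] by blast
  then have "scl c x \<in> orth ip (null_space A)" "A (scl c x) = Some (scl c u)"
    "scl c v \<in> orth ip (ran A)" "scl c y = scl c u + scl c v"
    by (auto intro: subspace_scale subspace_orth linear_operator_scale A simp: scale_right_distrib)
  then show "pseudoinverse ip A (scl c y) = Some (scl c x)"
    unfolding pseudoinverse_eq_Some_iff[OF A] by blast
qed

lemma null_space_pseudoinverse: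
  assumes A: "linear_operator scl A" "closed (null_space A)"
  shows "null_space (pseudoinverse ip A) = orth ip (ran A)"
  using linear_operator_zero[OF A(1)] subspace_0[OF subspace_orth]
  by (auto simp: null_space_def[of "pseudoinverse ip A"] pseudoinverse_eq_Some_iff[OF A])

text \<open>Each \<open>x\<close> on the right is the value at \<open>A x\<close>, with 0 as the
  component orthogonal to the range. For everywhere defined \<open>A\<close> the set is the full
  complement of the null space.\<close>

lemma ran_pseudoinverse:
  assumes A: "linear_operator scl A" "closed (null_space A)"
  shows "ran (pseudoinverse ip A) = dom A \<inter> orth ip (null_space A)"
proof -
  have "0 \<in> orth ip (ran A)" by (rule subspace_0[OF subspace_orth])
  then show ?thesis
    unfolding ran_def[of "pseudoinverse ip A"] pseudoinverse_eq_Some_iff[OF A] by blast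
qed

text \<open>A vector orthogonal to the domain is orthogonal to the range and to the complement of
  the range, hence to itself.\<close>

lemma closure_dom_pseudoinverse:
  assumes A: "linear_operator scl A"
  shows "closure (dom (pseudoinverse ip A)) = UNIV"
  unfolding dom_pseudoinverse
proof (rule closure_eq_UNIV)
  show "subspace (ran A + orth ip (ran A))"
    by (intro subspace_set_plus subspace_ran subspace_orth A)
  have "ran A \<subseteq> ran A + orth ip (ran A)" "orth ip (ran A) \<subseteq> ran A + orth ip (ran A)"
    using set_zero_plus2[OF subspace_0[OF subspace_orth[of "ran A"]], of "ran A"]
      set_zero_plus2[OF subspace_0[OF subspace_ran[OF A]], of "orth ip (ran A)"]
    by (simp_all add: add.commute)
  then have "orth ip (ran A + orth ip (ran A)) \<subseteq> orth ip (ran A) \<inter> orth ip (orth ip (ran A))"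
    by (auto simp: orth_def)
  then show "orth ip (ran A + orth ip (ran A)) \<subseteq> {0}" using Int_orth by blast
qed

text \<open>By \<open>ran_pseudoinverse\<close>, this recovers the null space of \<open>A\<close>
  from the range of its pseudoinverse. Density of \<open>dom A\<close> enters the involution
  here.\<close>

lemma orth_dom_Int_orth_null_space:
  assumes A: "linear_operator scl A" "closed (null_space A)" and dense: "closure (dom A) = UNIV"
  shows "orth ip (dom A \<inter> orth ip (null_space A)) = null_space A"
proof
  let ?N = "null_space A"
  show "orth ip (dom A \<inter> orth ip ?N) \<subseteq> ?N"
  proof
    fix z assume z: "z \<in> orth ip (dom A \<inter> orth ip ?N)"
    obtain n where n: "n \<in> ?N" "z - n \<in> orth ip ?N"
      using orthogonal_decomposition[OF subspace_null_space[OF A(1)] A(2)] .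
    have "n \<in> orth ip (dom A \<inter> orth ip ?N)"
      using n(1) in_orthD' by (auto simp: orth_def[of _ "_ \<inter> _"])
    then have m: "z - n \<in> orth ip (dom A \<inter> orth ip ?N)"
      using z by (intro subspace_diff subspace_orth)
    \<comment> \<open>Split \<open>y\<close> into a part in the null space and a part in the domain
      orthogonal to it; \<open>z - n\<close> is orthogonal to both.\<close>
    have "ip (z - n) y = 0" if "y \<in> dom A" for y
    proof -
      obtain u where "A y = Some u" using \<open>y \<in> dom A\<close> by blast
      then obtain x where x: "x \<in> orth ip ?N" "A x = Some u" "y - x \<in> ?N"
        using linear_operator_decomposition[OF A] by blast
      have "ip (z - n) x = 0" using m x in_orthD by blast
      moreover have "ip (z - n) (y - x) = 0" using n(2) x(3) by (rule in_orthD)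
      ultimately show ?thesis using ip_diff_right[of "z - n" y x] by simp
    qed
    then have "z - n \<in> orth ip (dom A)" by (simp add: orth_def)
    then have "z - n = 0" using orth_eq_zeroI[OF dense] by blast
    then show "z \<in> ?N" using n(1) by simp
  qed
  show "?N \<subseteq> orth ip (dom A \<inter> orth ip ?N)"
    using in_orthD' by (auto simp: orth_def[of _ "_ \<inter> _"])
qed

lemma pseudoinverse_pseudoinverse:
  assumes A: "linear_operator scl A" "closed (null_space A)" and dense: "closure (dom A) = UNIV"
  shows "pseudoinverse ip (pseudoinverse ip A) = A"
proof -
  let ?B = "pseudoinverse ip A"
  have B: "linear_operator scl ?B" by (rule linear_operator_pseudoinverse[OF A])
  have null: "null_space ?B = orth ip (ran A)" by (rule null_space_pseudoinverse[OF A])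
  have B': "closed (null_space ?B)" unfolding null by (rule closed_orth)
  have ran: "orth ip (ran ?B) = null_space A"
    by (simp add: ran_pseudoinverse[OF A] orth_dom_Int_orth_null_space[OF A dense])
  have "pseudoinverse ip ?B y = Some x \<longleftrightarrow> A y = Some x" for x y
  proof
    assume "pseudoinverse ip ?B y = Some x"
    then obtain w n where x: "x \<in> orth ip (orth ip (ran A))" and w: "?B x = Some w"
      and n: "A n = Some 0" and y: "y = w + n"
      unfolding pseudoinverse_eq_Some_iff[OF B B'] null ran by (auto simp: null_space_def)
    obtain u v where uv: "A w = Some u" "v \<in> orth ip (ran A)" "x = u + v"
      using w unfolding pseudoinverse_eq_Some_iff[OF A] by blast
    \<comment> \<open>The range need not be closed, so \<open>x\<close> is only known to lie in its
      double complement. So does \<open>u\<close>, hence also \<open>v\<close>, which is at the same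
      time in the single complement and therefore 0.\<close>
    have "u \<in> orth ip (orth ip (ran A))" using ranI[of A w, OF uv(1)] subset_orth_orth by blast
    then have "x - u \<in> orth ip (orth ip (ran A))" by (intro subspace_diff subspace_orth x)
    then have "v = 0" using uv(2,3) Int_orth[of v "orth ip (ran A)"] by simp
    then show "A y = Some x" using linear_operator_add[OF A(1) uv(1) n] uv(3) y by simp
  next
    assume Ay: "A y = Some x"
    obtain w where w: "w \<in> orth ip (null_space A)" "A w = Some x" "y - w \<in> null_space A"
      using linear_operator_decomposition[OF A Ay] .
    have "?B x = Some w"
      unfolding pseudoinverse_eq_Some_iff[OF A]
      using w subspace_0[OF subspace_orth] by (metis add.right_neutral)
    moreover have "y = w + (y - w)" by simp
    moreover have "x \<in> orth ip (orth ip (ran A))" using ranI[of A y, OF Ay] subset_orth_orth by blast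
    ultimately show "pseudoinverse ip ?B y = Some x"
      unfolding pseudoinverse_eq_Some_iff[OF B B'] null ran using w(3) by blast
  qed
  then have "pseudoinverse ip ?B y = A y" for y by (metis not_Some_eq)
  then show ?thesis by blast
qed

section \<open>Products of projections and closed unbounded projections\<close>

lemma orthogonal_projectionD:
  assumes "orthogonal_projection scl ip P"
  shows "P (P x) = P x" "ip (P x) y = ip x (P y)" "P (x - y) = P x - P y"
    "P (x + y) = P x + P y" "P (scl c x) = scl c (P x)" "P 0 = 0" "bounded_linear P"
  using assms bounded_linear.linear[THEN linear_diff, of P]
    bounded_linear.linear[THEN linear_add, of P]
    bounded_linear.linear[THEN linear_0, of P]
  by (auto simp: orthogonal_projection_def bounded_operator_def fun_eq_iff)

lemma projection_products_operator:
  assumes "T \<in> projection_products scl ip"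
  shows "linear_operator scl (Some \<circ> T)" "closed (null_space (Some \<circ> T))"
    "closure (dom (Some \<circ> T)) = UNIV"
proof -
  from assms obtain P Q where T: "T = P \<circ> Q"
    and P: "orthogonal_projection scl ip P" and Q: "orthogonal_projection scl ip Q"
    by (auto simp: projection_products_def)
  have dom: "dom (Some \<circ> T) = UNIV" by auto
  show "linear_operator scl (Some \<circ> T)"
    by (rule linear_operatorI, unfold dom)
      (auto simp: T orthogonal_projectionD[OF P] orthogonal_projectionD[OF Q])
  show "closure (dom (Some \<circ> T)) = UNIV" by (simp add: dom)
  have "bounded_linear T"
    unfolding T comp_def
    using orthogonal_projectionD(7)[OF P] orthogonal_projectionD(7)[OF Q]
    by (rule bounded_linear_compose)
  then have "continuous_on UNIV T" by (simp add: linear_continuous_on)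
  then have "closed {x. T x = 0}" by (intro closed_Collect_eq) simp_all
  then show "closed (null_space (Some \<circ> T))" by (simp add: null_space_def)
qed

text \<open>The null space and range of \<open>E\<close> are orthogonal complements, hence closed.
  The remaining algebraic conditions follow once every vector of the range is seen to be a fixed
  point.\<close>

lemma pseudoinverse_projection_product:
  assumes "T \<in> projection_products scl ip"
  shows "pseudoinverse ip (Some \<circ> T) \<in> closed_unbounded_projections scl"
proof -
  define A where "A = Some \<circ> T"
  define E where "E = pseudoinverse ip A"
  from assms obtain P Q where T: "T = P \<circ> Q"
    and P: "orthogonal_projection scl ip P" and Q: "orthogonal_projection scl ip Q"
    by (auto simp: projection_products_def)
  note A = projection_products_operator[OF assms, folded A_def]
  note P = orthogonal_projectionD[OF P] and Q = orthogonal_projectionD[OF Q]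
  have E: "linear_operator scl E" unfolding E_def by (rule linear_operator_pseudoinverse[OF A(1,2)])
  have null: "null_space E = orth ip (ran A)"
    unfolding E_def by (rule null_space_pseudoinverse[OF A(1,2)])
  have ran: "ran E = orth ip (null_space A)"
    unfolding E_def ran_pseudoinverse[OF A(1,2)] by (auto simp: A_def)
  have fixed: "E x = Some x" if x: "x \<in> orth ip (null_space A)" for x
  proof -
    \<comment> \<open>\<open>Q\<close> and hence \<open>T\<close> kills \<open>x - Q x\<close>. Both
      \<open>x\<close> and \<open>Q x\<close> are orthogonal to this difference, so it is orthogonal
      to itself.\<close>
    have "x - Q x \<in> null_space A" by (simp add: null_space_def A_def T Q P)
    then have "ip x (x - Q x) = 0" by (rule in_orthD[OF x])
    moreover have "ip (Q x) (x - Q x) = 0" by (simp add: Q)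
    ultimately have "ip (x - Q x) (x - Q x) = 0" by (simp add: ip_diff_left)
    then have "Q x = x" by simp
    then have "ip (x - T x) (T z) = 0" for z
      using P(2)[of "x - P x" "Q z"] by (simp add: T P)
    then have "x - T x \<in> orth ip (ran A)" by (auto simp: orth_def ran_def A_def)
    moreover have "x = T x + (x - T x)" by simp
    ultimately show ?thesis
      unfolding E_def pseudoinverse_eq_Some_iff[OF A(1,2)] using x by (auto simp: A_def)
  qed
  have E_E: "E y = Some y" if "E x = Some y" for x y
    using fixed ran ranI[of E x, OF that] by blast
  then have idem: "\<forall>x\<in>dom E. E (the (E x)) = E x" by auto
  have "dom E = null_space E + ran E"
  proof
    show "dom E \<subseteq> null_space E + ran E"
    proof
      fix x assume "x \<in> dom E"
      \<comment> \<open>The splitting is \<open>x = (x - E x) + E x\<close>; idempotence puts the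
        first summand into the null space.\<close>
      then obtain y where y: "E x = Some y" by blast
      then have "E (x - y) = Some (y - y)"
        using E_E by (intro linear_operator_diff[OF E])
      then have "x - y \<in> null_space E" by (simp add: null_space_def)
      then have "(x - y) + y \<in> null_space E + ran E" using ranI[of E x, OF y] by (rule set_plus_intro)
      then show "x \<in> null_space E + ran E" by simp
    qed
    have "null_space E \<subseteq> dom E" "ran E \<subseteq> dom E" using fixed ran by (auto simp: null_space_def)
    then show "null_space E + ran E \<subseteq> dom E"
      using subspace_add[OF subspace_dom[OF E]] by (blast elim: set_plus_elim)
  qed
  moreover have "null_space E \<inter> ran E = {0}"
  proof -
    have "x = 0" if "x \<in> null_space E" "x \<in> ran E" for x
      using that fixed ran by (auto simp: null_space_def)
    moreover have "0 \<in> null_space E" "0 \<in> ran E"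
      using E by (auto intro: subspace_0 subspace_null_space subspace_ran)
    ultimately show ?thesis by blast
  qed
  moreover have "closure (dom E) = UNIV"
    unfolding E_def by (rule closure_dom_pseudoinverse[OF A(1)])
  moreover have "closed (null_space E)" "closed (ran E)"
    unfolding null ran by (rule closed_orth)+
  ultimately have "E \<in> closed_unbounded_projections scl"
    unfolding closed_unbounded_projections_def mem_Collect_eq using E idem by (intro conjI)
  then show ?thesis by (simp add: E_def A_def)
qed

lemma pseudoinverse_closed_unbounded_projection:
  assumes "E \<in> closed_unbounded_projections scl"
  shows "\<exists>T\<in>projection_products scl ip. pseudoinverse ip E = Some \<circ> T"
proof -
  have E: "linear_operator scl E" "closed (null_space E)" and ran: "closed (ran E)"
    and idem: "\<And>x. x \<in> dom E \<Longrightarrow> E (the (E x)) = E x"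
    using assms by (auto simp: closed_unbounded_projections_def)
  obtain P where P: "orthogonal_projection scl ip P" "\<And>x. P x \<in> orth ip (null_space E)"
    "\<And>x. x - P x \<in> orth ip (orth ip (null_space E))"
    using obtain_orthogonal_projection[OF subspace_orth closed_orth] by blast
  obtain Q where Q: "orthogonal_projection scl ip Q" "\<And>x. Q x \<in> ran E"
    "\<And>x. x - Q x \<in> orth ip (ran E)"
    using obtain_orthogonal_projection[OF subspace_ran[OF E(1)] ran] by blast
  have "pseudoinverse ip E y = Some (P (Q y))" for y
  proof -
    \<comment> \<open>\<open>P\<close> leaves a remainder in the double complement of the null
      space, which is the closed null space itself. Hence \<open>E\<close> takes the same value at
      \<open>P (Q y)\<close> as at \<open>Q y\<close>, a fixed point by idempotence.\<close>
    have "Q y - P (Q y) \<in> null_space E"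
      using P(3) orth_orth[OF subspace_null_space[OF E(1)] E(2)] by simp
    moreover have EQ: "E (Q y) = Some (Q y)" using Q(2)[of y] idem by (force simp: ran_def)
    ultimately have "E (P (Q y)) = Some (Q y)"
      using linear_operator_diff[OF E(1) EQ, of "Q y - P (Q y)" 0] by (simp add: null_space_def)
    moreover have "y = Q y + (y - Q y)" by simp
    ultimately show ?thesis
      unfolding pseudoinverse_eq_Some_iff[OF E] using P(2) Q(3) by blast
  qed
  then have "pseudoinverse ip E = Some \<circ> (P \<circ> Q)" by (simp add: fun_eq_iff)
  moreover have "P \<circ> Q \<in> projection_products scl ip"
    using P(1) Q(1) by (auto simp: projection_products_def)
  ultimately show ?thesis by blast
qed

end

theorem theorem6p2:
  fixes scl :: "'k::rc_field \<Rightarrow> 'a::banach \<Rightarrow> 'a"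
    and ip :: "'a \<Rightarrow> 'a \<Rightarrow> 'k"
  assumes "hilbert_space scl ip"
  shows "(\<forall>T\<in>projection_products scl ip.
            \<exists>E\<in>closed_unbounded_projections scl. Some \<circ> T = pseudoinverse ip E) \<and>
         (\<forall>E\<in>closed_unbounded_projections scl.
            \<exists>T\<in>projection_products scl ip. pseudoinverse ip E = Some \<circ> T) \<and>
         bij_betw (\<lambda>T. pseudoinverse ip (Some \<circ> T))
           (projection_products scl ip) (closed_unbounded_projections scl)"
proof -
  interpret hilbert_space scl ip by (rule assms)
  let ?X = "projection_products scl ip" and ?Q = "closed_unbounded_projections scl"
  let ?f = "\<lambda>T. pseudoinverse ip (Some \<circ> T)"
  have f: "?f T \<in> ?Q" if "T \<in> ?X" for T
    using that by (rule pseudoinverse_projection_product)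
  have T: "pseudoinverse ip (?f T) = Some \<circ> T" if "T \<in> ?X" for T
    by (intro pseudoinverse_pseudoinverse projection_products_operator that)
  have E: "pseudoinverse ip (pseudoinverse ip E) = E" if "E \<in> ?Q" for E
    using that by (intro pseudoinverse_pseudoinverse) (auto simp: closed_unbounded_projections_def)
  have g: "\<exists>T\<in>?X. pseudoinverse ip E = Some \<circ> T" if "E \<in> ?Q" for E
    using that by (rule pseudoinverse_closed_unbounded_projection)
  have "inj_on ?f ?X"
  proof (rule inj_onI)
    fix S U assume "S \<in> ?X" "U \<in> ?X" "?f S = ?f U"
    then have "Some \<circ> S = Some \<circ> U" using T by metis
    then show "S = U" by (simp add: fun_eq_iff)
  qed
  \<comment> \<open>The preimage of \<open>E\<close> is the \<open>T\<close> that represents the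
    pseudoinverse of \<open>E\<close>; a second pseudoinverse returns \<open>E\<close>.\<close>
  moreover have "E \<in> ?f ` ?X" if "E \<in> ?Q" for E
    using g[OF that] E[OF that] by (metis imageI)
  ultimately have "bij_betw ?f ?X ?Q" using f by (auto simp: bij_betw_def)
  moreover have "\<exists>E\<in>?Q. Some \<circ> T = pseudoinverse ip E" if "T \<in> ?X" for T
    using f[OF that] T[OF that] by metis
  ultimately show ?thesis using g by blast
qed

end
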